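(* Let $N\in\mathbb N$, $\tau\in(0,1/2)$, $\delta=\tau N$, $\lambda\ge 0$, $L=N(1+\lambda)$, $m\in\mathbb N\setminus\{1\}$, and $f\in\mathcal B_\delta(\mathbb R)$. Let $\varepsilon>0$ and $\tilde f_\ell=f\big(\frac{\ell}{L}\big)+\varepsilon_\ell$ with $|\varepsilon_\ell|\le\varepsilon$ for all $\ell\in\mathbb Z$. Let $R_{\sinh,m}f$ and $R_{\sinh,m}\tilde f$ be the regularized Shannon sampling formulas with exact and with noisy samples for the $\sinh$-type window function $\varphi_{\sinh}$ with parameter $\beta=\frac{\pi m(1+\lambda-2\tau)}{1+\lambda}$. Then $$\|R_{\sinh,m}\tilde f-R_{\sinh,m}f\|_{C_0(\mathbb R)}\le\varepsilon\left(2+\sqrt{\frac{2+2\lambda}{1+\lambda-2\tau}}\;\frac{1}{1-\mathrm e^{-2\beta}}\,\sqrt m\right).$$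
   Context: $\mathrm{sinc}\,x=\frac{\sin x}{x}$ for $x\ne0$ and $\mathrm{sinc}\,0=1$. $\|g\|_{C_0(\mathbb R)}:=\max_{t\in\mathbb R}|g(t)|$ (read as a supremum if the maximum is not attained). Fourier transform: $\hat f(v)=\int_{\mathbb R}f(t)\,\mathrm e^{-2\pi\mathrm i tv}\,\mathrm dt$ (extended to $L^2(\mathbb R)$ by Plancherel). Paley--Wiener space: $\mathcal B_\delta(\mathbb R)=\{f\in L^2(\mathbb R):\ \mathrm{supp}\,\hat f\subseteq[-\delta,\delta]\}$; each element is identified with its smooth representative, so point values make sense. The $\sinh$-type window function with parameter $\beta>0$ is $$\varphi_{\sinh}(x)=\begin{cases}\frac{1}{\sinh\beta}\,\sinh\big(\beta\sqrt{1-(Lx/m)^2}\big)&x\in[-m/L,m/L],\\0&x\in\mathbb R\setminus[-m/L,m/L].\end{cases}$$ For a real or complex sequence $(g_\ell)_{\ell\in\mathbb Z}$ the regularized Shannon sampling formula with localized sampling for this window is $$t\mapsto\sum_{\ell\in\mathbb Z}g_\ell\,\mathrm{sinc}\big(L\pi(t-\tfrac{\ell}{L})\big)\,\varphi_{\sinh}\big(t-\tfrac{\ell}{L}\big),\quad t\in\mathbb R;$$ it is denoted $R_{\sinh,m}f$ when $g_\ell=f(\ell/L)$ and $R_{\sinh,m}\tilde f$ when $g_\ell=\tilde f_\ell$. *)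

theory Defs
  imports "HOL-Probability.Probability"
begin

definition fourier_integral :: "(real \<Rightarrow> complex) \<Rightarrow> real \<Rightarrow> complex" where
  "fourier_integral f v = (LINT t|lborel. f t * exp (- (2 * of_real pi * \<i> * of_real t * of_real v)))"

definition square_integrable :: "(real \<Rightarrow> complex) \<Rightarrow> bool" where
  "square_integrable f \<longleftrightarrow>
     f \<in> borel_measurable lborel \<and> integrable lborel (\<lambda>t. (norm (f t))\<^sup>2)"

text \<open>
  The Plancherel extension: the Fourier transform on the integrable square-integrable functions,
  extended by continuity to all square-integrable functions. Transforms are determined only up to
  equality almost everywhere, so this is a relation. The distances are nonnegative integrals, to
  avoid the value 0 that the Bochner integral assigns to non-integrable functions.
\<close>

definition is_fourier_transform_L2 :: "(real \<Rightarrow> complex) \<Rightarrow> (real \<Rightarrow> complex) \<Rightarrow> bool" where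
  "is_fourier_transform_L2 f g \<longleftrightarrow> square_integrable f \<and> square_integrable g \<and>
     (\<exists>F :: nat \<Rightarrow> real \<Rightarrow> complex.
        (\<forall>n. integrable lborel (F n) \<and> square_integrable (F n)) \<and>
        (\<lambda>n. \<integral>\<^sup>+ t. ennreal ((norm (F n t - f t))\<^sup>2) \<partial>lborel) \<longlonglongrightarrow> 0 \<and>
        (\<lambda>n. \<integral>\<^sup>+ v. ennreal ((norm (fourier_integral (F n) v - g v))\<^sup>2) \<partial>lborel) \<longlonglongrightarrow> 0)"

text \<open>The support of a function defined up to null sets: the complement of the largest open set
  on which it vanishes almost everywhere.\<close>

definition ess_support :: "(real \<Rightarrow> complex) \<Rightarrow> real set" where
  "ess_support g = - \<Union>{U. open U \<and> (AE v in lborel. v \<in> U \<longrightarrow> g v = 0)}"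

definition smooth :: "(real \<Rightarrow> complex) \<Rightarrow> bool" where
  "smooth f \<longleftrightarrow> (\<exists>D :: nat \<Rightarrow> real \<Rightarrow> complex. D 0 = f \<and>
     (\<forall>k t. (D k has_vector_derivative D (Suc k) t) (at t)))"

text \<open>Each element of the Paley--Wiener space is represented by its smooth representative.\<close>

definition paley_wiener :: "real \<Rightarrow> (real \<Rightarrow> complex) set" where
  "paley_wiener \<delta> = {f. smooth f \<and> square_integrable f \<and>
     (\<exists>g. is_fourier_transform_L2 f g \<and> ess_support g \<subseteq> {-\<delta>..\<delta>})}"

definition sinh_window :: "real \<Rightarrow> nat \<Rightarrow> real \<Rightarrow> real \<Rightarrow> real" where
  "sinh_window L m \<beta> x =
     (if x \<in> {- (real m / L)..real m / L}
      then 1 / sinh \<beta> * sinh (\<beta> * sqrt (1 - (L * x / real m)\<^sup>2))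
      else 0)"

text \<open>As the window has compact support, only finitely many terms of the series are nonzero for
  each t.\<close>

definition shannon_sinh :: "real \<Rightarrow> nat \<Rightarrow> real \<Rightarrow> (int \<Rightarrow> complex) \<Rightarrow> real \<Rightarrow> complex" where
  "shannon_sinh L m \<beta> g t =
     (\<Sum>\<^sub>\<infinity>l\<in>UNIV. g l * of_real (sinc (L * pi * (t - of_int l / L)))
                       * of_real (sinh_window L m \<beta> (t - of_int l / L)))"

text \<open>Values in the extended nonnegative reals, so that a bound on it includes boundedness of the function.\<close>

definition C0_norm :: "(real \<Rightarrow> complex) \<Rightarrow> ennreal" where
  "C0_norm g = (SUP t. ennreal (norm (g t)))"

end

theory Submission
  imports Defs
begin

text \<open>
  Both series have only finitely many nonzero terms at each point, so their difference is the same
  series with the perturbations as coefficients. At \<open>t\<close> it is bounded by \<open>\<epsilon>\<close> times the sum over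
  \<open>l\<close> of the window values at \<open>t - l / L\<close>, as the sinc factors have absolute value at most 1. It
  remains to bound this sum uniformly in \<open>t\<close>.

  In units of the sample spacing the sample points are the points \<open>u = L t - l\<close>, of which at most
  two satisfy \<open>\<bar>u\<bar> < 1\<close>. There the window is at most 1, which gives the summand 2. For the others,
  \<open>sinh z \<le> exp z / 2\<close> and \<open>sqrt (1 - s) \<le> 1 - s / 2\<close> show that the window lies below the Gaussian
  \<open>exp (- \<beta> (u / m)\<^sup>2 / 2) / (1 - exp (- 2 \<beta>))\<close> (lemma \<open>sinh_window_le_gaussian\<close>), and a
  function decreasing away from 0 is bounded at \<open>u\<close> by its integral over the unit interval next to
  \<open>u\<close> on the side of 0. These intervals do not overlap, so the remaining sum is at most the integral
  of the Gaussian (lemma \<open>sum_shifts_le_integral\<close>), namely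
  \<open>m sqrt (2 pi / \<beta>) / (1 - exp (- 2 \<beta>))\<close>. The given value of \<open>\<beta>\<close> turns
  \<open>m sqrt (2 pi / \<beta>)\<close> into the factor in the claim. The Gaussian majorant loses nothing to leading
  order for large \<open>\<beta>\<close>: it reproduces the classical bound \<open>exp \<beta> / sqrt (2 pi \<beta>)\<close> for
  the modified Bessel function \<open>I\<^sub>1\<close>, in terms of which the integral of the window can be expressed.
\<close>

text \<open>The comparison of a sum with an integral, for a function that decreases away from 0 and an
  arbitrary shift: each point is charged to the unit interval that joins it to its neighbour nearer
  to 0. The condition \<open>1 \<le> \<bar>x - of_int l\<bar>\<close> keeps these intervals on their side of 0, hence
  disjoint.\<close>

lemma sum_shifts_le_integral:
  fixes g :: "real \<Rightarrow> real" and x :: real and A :: "int set"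
  assumes "finite A" and far: "\<And>l. l \<in> A \<Longrightarrow> 1 \<le> \<bar>x - of_int l\<bar>"
    and int: "integrable lborel g" and nonneg: "\<And>y. 0 \<le> g y"
    and mono: "\<And>u y. \<bar>y\<bar> \<le> \<bar>u\<bar> \<Longrightarrow> g u \<le> g y"
  shows "(\<Sum>l\<in>A. g (x - of_int l)) \<le> (LINT y|lborel. g y)"
proof -
  define I where "I l = (if of_int l < x then {x - of_int l - 1<..<x - of_int l}
                          else {x - of_int l<..<x - of_int l + 1})" for l :: int
  have I_meas: "I l \<in> sets lborel" for l
    by (auto simp: I_def)
  have g_on: "set_integrable lborel B g" if "B \<in> sets lborel" for B
    using integrable_mult_indicator[OF that int] by (simp add: set_integrable_def)
  have const_on: "set_integrable lborel (I l) (\<lambda>_. c)" "(LINT y:I l|lborel. c) = c"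
    for l and c :: real
    by (auto simp: I_def set_integrable_def set_lebesgue_integral_def)
  have disj: "disjoint_family_on I A"
    unfolding disjoint_family_on_def
  proof (intro ballI impI)
    fix k l assume kl: "k \<in> A" "l \<in> A" "k \<noteq> l"
    then have "real_of_int k + 1 \<le> of_int l \<or> real_of_int l + 1 \<le> of_int k"
      by linarith
    then show "I k \<inter> I l = {}"
      using far[OF kl(1)] far[OF kl(2)] by (auto simp: I_def)
  qed
  have "g (x - of_int l) \<le> (LINT y:I l|lborel. g y)" if "l \<in> A" for l
  proof -
    have "g (x - of_int l) = (LINT y:I l|lborel. g (x - of_int l))"
      by (simp add: const_on)
    also have "\<dots> \<le> (LINT y:I l|lborel. g y)"
      using far[OF that]
      by (intro set_integral_mono const_on g_on I_meas mono) (auto simp: I_def split: if_splits)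
    finally show ?thesis .
  qed
  then have "(\<Sum>l\<in>A. g (x - of_int l)) \<le> (\<Sum>l\<in>A. LINT y:I l|lborel. g y)"
    by (rule sum_mono)
  also have "\<dots> = (LINT y:(\<Union>l\<in>A. I l)|lborel. g y)"
    using assms(1) disj by (intro set_integral_finite_Union[symmetric] g_on I_meas) auto
  also have "\<dots> \<le> (LINT y|lborel. g y)"
    unfolding set_lebesgue_integral_def
  proof (rule integral_mono)
    have "(\<Union>l\<in>A. I l) \<in> sets lborel"
      using assms(1) I_meas by auto
    from g_on[OF this] show "integrable lborel (\<lambda>y. indicat_real (\<Union>l\<in>A. I l) y *\<^sub>R g y)"
      by (simp add: set_integrable_def)
  qed (auto intro: int nonneg simp: indicator_def)
  finally show ?thesis .
qed

text \<open>At the points within distance 1 of 0, of which there are at most two, the interval towards 0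
  is too short for the comparison with the integral, so the bound 1 on \<open>h\<close> is used there.\<close>

lemma sum_shifts_le_two_plus_integral:
  fixes h g :: "real \<Rightarrow> real" and x :: real and A :: "int set"
  assumes "finite A" and h1: "\<And>u. h u \<le> 1" and hg: "\<And>u. h u \<le> g u"
    and "integrable lborel g" and "\<And>y. 0 \<le> g y"
    and "\<And>u y. \<bar>y\<bar> \<le> \<bar>u\<bar> \<Longrightarrow> g u \<le> g y"
  shows "(\<Sum>l\<in>A. h (x - of_int l)) \<le> 2 + (LINT y|lborel. g y)"
proof -
  define B where "B = {l \<in> A. \<bar>x - of_int l\<bar> < 1}"
  have "B \<subseteq> {\<lfloor>x\<rfloor>, \<lfloor>x\<rfloor> + 1}"
    unfolding B_def by (auto, linarith)
  then have "card B \<le> card {\<lfloor>x\<rfloor>, \<lfloor>x\<rfloor> + 1}"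
    by (intro card_mono) auto
  then have "card B \<le> 2"
    by simp
  have "(\<Sum>l\<in>B. h (x - of_int l)) \<le> (\<Sum>l\<in>B. 1)"
    by (intro sum_mono h1)
  also have "\<dots> \<le> 2"
    using \<open>card B \<le> 2\<close> by simp
  finally have near: "(\<Sum>l\<in>B. h (x - of_int l)) \<le> 2" .
  have "(\<Sum>l\<in>A - B. h (x - of_int l)) \<le> (\<Sum>l\<in>A - B. g (x - of_int l))"
    by (intro sum_mono hg)
  also have "\<dots> \<le> (LINT y|lborel. g y)"
    using assms by (intro sum_shifts_le_integral) (auto simp: B_def)
  finally have "(\<Sum>l\<in>A - B. h (x - of_int l)) \<le> (LINT y|lborel. g y)" .
  moreover have "(\<Sum>l\<in>A. h (x - of_int l))
      = (\<Sum>l\<in>A - B. h (x - of_int l)) + (\<Sum>l\<in>B. h (x - of_int l))"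
    using assms(1) by (intro sum.subset_diff) (auto simp: B_def)
  ultimately show ?thesis
    using near by linarith
qed

lemma gaussian_integral:
  fixes a :: real
  assumes "a > 0"
  shows "integrable lborel (\<lambda>u. exp (- a * u\<^sup>2 / 2))"
    and "(LINT u|lborel. exp (- a * u\<^sup>2 / 2)) = sqrt (2 * pi / a)"
proof -
  define \<sigma> where "\<sigma> = sqrt (1 / a)"
  have \<sigma>: "\<sigma> > 0" "\<sigma>\<^sup>2 = 1 / a"
    using assms by (auto simp: \<sigma>_def)
  have eq: "(\<lambda>u. exp (- a * u\<^sup>2 / 2)) = (\<lambda>u. sqrt (2 * pi / a) * normal_density 0 \<sigma> u)"
    using assms \<sigma> by (simp add: normal_density_def fun_eq_iff)
  show "integrable lborel (\<lambda>u. exp (- a * u\<^sup>2 / 2))"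
    unfolding eq using \<sigma> by (intro integrable_mult_right integrable_normal_density)
  show "(LINT u|lborel. exp (- a * u\<^sup>2 / 2)) = sqrt (2 * pi / a)"
    unfolding eq using \<sigma> by (simp add: integral_normal_density)
qed

lemma abs_sinc_le_one: "\<bar>sinc x\<bar> \<le> 1"
  using abs_sin_x_le_abs_x[of x] by (auto simp: divide_le_eq)

lemma sinh_window_eq:
  assumes "L > 0" "m > 0"
  shows "sinh_window L m \<beta> x =
    (if \<bar>L * x / real m\<bar> \<le> 1 then sinh (\<beta> * sqrt (1 - (L * x / real m)\<^sup>2)) / sinh \<beta> else 0)"
proof -
  have "x \<in> {- (real m / L)..real m / L} \<longleftrightarrow> \<bar>L * x / real m\<bar> \<le> 1"
    using assms by (auto simp: abs_le_iff field_simps)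
  then show ?thesis
    by (simp add: sinh_window_def)
qed

lemma sinh_window_bounds:
  assumes "\<beta> > 0" "L > 0" "m > 0"
  shows sinh_window_nonneg: "0 \<le> sinh_window L m \<beta> x"
    and sinh_window_le_one: "sinh_window L m \<beta> x \<le> 1"
proof -
  define r where "r = sqrt (1 - (L * x / real m)\<^sup>2)"
  have "0 \<le> sinh (\<beta> * r) / sinh \<beta> \<and> sinh (\<beta> * r) / sinh \<beta> \<le> 1" if "\<bar>L * x / real m\<bar> \<le> 1"
  proof -
    have "(L * x / real m)\<^sup>2 \<le> 1"
      using that by (simp only: abs_square_le_1)
    then have "0 \<le> r" "r \<le> 1"
      by (auto simp: r_def)
    then show ?thesis
      using assms(1) by (auto simp: mult_left_le)
  qed
  then show "0 \<le> sinh_window L m \<beta> x" "sinh_window L m \<beta> x \<le> 1"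
    unfolding sinh_window_eq[OF assms(2,3)] r_def by auto
qed

text \<open>The tangent of the square root at 1 turns the semicircle in the exponent into a parabola. The
  prefactor is \<open>exp \<beta> / (2 sinh \<beta>)\<close>.\<close>

lemma sinh_window_le_gaussian:
  assumes "\<beta> > 0" "L > 0" "m > 0"
  shows "sinh_window L m \<beta> x
    \<le> 1 / (1 - exp (- 2 * \<beta>)) * exp (- \<beta> * (L * x / real m)\<^sup>2 / 2)"
proof -
  define v where "v = (L * x / real m)\<^sup>2"
  have sb: "sinh \<beta> > 0" and pos: "1 - exp (- 2 * \<beta>) > 0"
    using assms by auto
  have bound: "sinh (\<beta> * sqrt (1 - v)) / sinh \<beta>
      \<le> 1 / (1 - exp (- 2 * \<beta>)) * exp (- \<beta> * v / 2)" if "v \<le> 1"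
  proof -
    have "1 - v \<le> (1 - v / 2)\<^sup>2"
      by (simp add: power2_eq_square algebra_simps)
    then have "sqrt (1 - v) \<le> 1 - v / 2"
      using that by (intro real_le_lsqrt) auto
    then have "\<beta> * sqrt (1 - v) \<le> \<beta> * (1 - v / 2)"
      using assms(1) by (intro mult_left_mono) auto
    then have "exp (\<beta> * sqrt (1 - v)) \<le> exp (\<beta> + - \<beta> * v / 2)"
      by (simp add: algebra_simps)
    moreover have "sinh (\<beta> * sqrt (1 - v)) \<le> exp (\<beta> * sqrt (1 - v)) / 2"
      by (simp add: sinh_field_def)
    ultimately have "sinh (\<beta> * sqrt (1 - v)) \<le> exp \<beta> * exp (- \<beta> * v / 2) / 2"
      unfolding exp_add by linarith
    then have "sinh (\<beta> * sqrt (1 - v)) / sinh \<beta> \<le> exp \<beta> * exp (- \<beta> * v / 2) / 2 / sinh \<beta>"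
      using sb by (intro divide_right_mono) auto
    also have "\<dots> = 1 / (1 - exp (- 2 * \<beta>)) * exp (- \<beta> * v / 2)"
    proof -
      have "sinh \<beta> = exp \<beta> * (1 - exp (- 2 * \<beta>)) / 2"
        by (simp add: sinh_def algebra_simps flip: exp_add)
      then show ?thesis
        by (simp only:) simp
    qed
    finally show ?thesis .
  qed
  have "v \<le> 1" if "\<bar>L * x / real m\<bar> \<le> 1"
    using that unfolding v_def by (simp only: abs_square_le_1)
  then show ?thesis
    using bound pos unfolding sinh_window_eq[OF assms(2,3)] v_def by auto
qed

text \<open>The stability constant: since sinc has absolute value at most 1, a bound on this sum bounds
  the norm of the sampling operator from bounded sequences to bounded functions.\<close>

lemma sum_sinh_window_le:
  assumes "\<beta> > 0" "L > 0" "m > 0" "finite A"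
  shows "(\<Sum>l\<in>A. sinh_window L m \<beta> (t - of_int l / L))
    \<le> 2 + 1 / (1 - exp (- 2 * \<beta>)) * (real m * sqrt (2 * pi / \<beta>))"
proof -
  define a where "a = \<beta> / (real m)\<^sup>2"
  define C where "C = 1 / (1 - exp (- 2 * \<beta>))"
  have "a > 0" "C > 0"
    using assms by (auto simp: a_def C_def)
  have gauss: "sinh_window L m \<beta> (u / L) \<le> C * exp (- a * u\<^sup>2 / 2)" for u
    using sinh_window_le_gaussian[OF assms(1-3), of "u / L"] assms(2)
    by (simp add: a_def C_def power_divide)
  have decr: "C * exp (- a * u\<^sup>2 / 2) \<le> C * exp (- a * y\<^sup>2 / 2)" if "\<bar>y\<bar> \<le> \<bar>u\<bar>" for u y
    using \<open>a > 0\<close> \<open>C > 0\<close> that by (simp add: abs_le_square_iff)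
  have "(\<Sum>l\<in>A. sinh_window L m \<beta> (t - of_int l / L))
      = (\<Sum>l\<in>A. sinh_window L m \<beta> ((L * t - of_int l) / L))"
    using assms(2) by (simp add: diff_divide_distrib)
  also have "\<dots> \<le> 2 + (LINT u|lborel. C * exp (- a * u\<^sup>2 / 2))"
    using assms \<open>C > 0\<close>
    by (intro sum_shifts_le_two_plus_integral[where h = "\<lambda>u. sinh_window L m \<beta> (u / L)"]
        gauss decr sinh_window_le_one integrable_mult_right gaussian_integral \<open>a > 0\<close>) auto
  also have "(LINT u|lborel. C * exp (- a * u\<^sup>2 / 2)) = C * sqrt (2 * pi / a)"
    by (simp only: integral_mult_right_zero gaussian_integral(2)[OF \<open>a > 0\<close>])
  also have "sqrt (2 * pi / a) = real m * sqrt (2 * pi / \<beta>)"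
  proof -
    have "2 * pi / a = (real m)\<^sup>2 * (2 * pi / \<beta>)"
      by (simp add: a_def)
    then show ?thesis
      by (simp only: real_sqrt_mult) simp
  qed
  finally show ?thesis by (simp add: C_def)
qed

lemma finite_sinh_window_support:
  assumes "L > 0"
  shows "finite {l::int. sinh_window L m \<beta> (t - of_int l / L) \<noteq> 0}"
proof (rule finite_subset)
  show "{l::int. sinh_window L m \<beta> (t - of_int l / L) \<noteq> 0} \<subseteq> {\<lfloor>L * t - m\<rfloor>..\<lceil>L * t + m\<rceil>}"
  proof
    fix l :: int assume "l \<in> {l. sinh_window L m \<beta> (t - of_int l / L) \<noteq> 0}"
    then have "- (real m / L) \<le> t - of_int l / L" "t - of_int l / L \<le> real m / L"
      by (auto simp: sinh_window_def split: if_splits)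
    then have "L * - (real m / L) \<le> L * (t - of_int l / L)"
        "L * (t - of_int l / L) \<le> L * (real m / L)"
      using assms by (simp_all only: mult_le_cancel_left_pos)
    then have "L * t - m \<le> of_int l" "of_int l \<le> L * t + m"
      using assms by (simp_all add: right_diff_distrib)
    then show "l \<in> {\<lfloor>L * t - m\<rfloor>..\<lceil>L * t + m\<rceil>}"
      by (auto; linarith)
  qed
qed simp

lemma norm_shannon_sinh_diff_le:
  assumes "\<beta> > 0" "L > 0" "m > 0" and e: "\<And>l. norm (g l - h l) \<le> \<epsilon>"
  shows "norm (shannon_sinh L m \<beta> g t - shannon_sinh L m \<beta> h t)
    \<le> \<epsilon> * (2 + 1 / (1 - exp (- 2 * \<beta>)) * (real m * sqrt (2 * pi / \<beta>)))"
proof -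
  define A where "A = {l::int. sinh_window L m \<beta> (t - of_int l / L) \<noteq> 0}"
  define s where "s l = sinc (L * pi * (t - of_int l / L))" for l :: int
  define w where "w l = sinh_window L m \<beta> (t - of_int l / L)" for l :: int
  have fin: "finite A"
    unfolding A_def by (rule finite_sinh_window_support) fact
  have finite_sum: "shannon_sinh L m \<beta> c t = (\<Sum>l\<in>A. c l * of_real (s l) * of_real (w l))" for c
  proof -
    have "shannon_sinh L m \<beta> c t = (\<Sum>\<^sub>\<infinity>l\<in>A. c l * of_real (s l) * of_real (w l))"
      unfolding shannon_sinh_def s_def w_def by (rule infsum_cong_neutral) (auto simp: A_def)
    then show ?thesis
      using fin by simp
  qed
  have "\<epsilon> \<ge> 0"
    using norm_ge_zero e by (rule order_trans)
  have w0: "w l \<ge> 0" for l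
    unfolding w_def using assms by (intro sinh_window_nonneg)
  have s1: "\<bar>s l\<bar> \<le> 1" for l
    unfolding s_def by (rule abs_sinc_le_one)
  have "norm (shannon_sinh L m \<beta> g t - shannon_sinh L m \<beta> h t)
      = norm (\<Sum>l\<in>A. (g l - h l) * of_real (s l) * of_real (w l))"
    unfolding finite_sum by (simp add: sum_subtractf algebra_simps)
  also have "\<dots> \<le> (\<Sum>l\<in>A. \<epsilon> * w l)"
  proof (rule sum_norm_le)
    fix l
    have "norm (g l - h l) * \<bar>s l\<bar> * w l \<le> \<epsilon> * 1 * w l"
      using \<open>\<epsilon> \<ge> 0\<close> by (intro mult_mono e s1 w0 mult_nonneg_nonneg) auto
    then show "norm ((g l - h l) * of_real (s l) * of_real (w l)) \<le> \<epsilon> * w l"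
      using w0[of l] by (simp add: norm_mult)
  qed
  also have "\<dots> = \<epsilon> * (\<Sum>l\<in>A. w l)"
    by (simp add: sum_distrib_left)
  also have "\<dots> \<le> \<epsilon> * (2 + 1 / (1 - exp (- 2 * \<beta>)) * (real m * sqrt (2 * pi / \<beta>)))"
    unfolding w_def using assms fin \<open>\<epsilon> \<ge> 0\<close> by (intro mult_left_mono sum_sinh_window_le)
  finally show ?thesis .
qed

theorem theorem6p3:
  fixes N m :: nat and \<tau> \<delta> lam L \<beta> \<epsilon> :: real
    and f :: "real \<Rightarrow> complex" and e ftilde :: "int \<Rightarrow> complex"
  assumes "N \<ge> 1"
    and "0 < \<tau>" and "\<tau> < 1 / 2"
    and "\<delta> = \<tau> * real N"
    and "lam \<ge> 0"
    and "L = real N * (1 + lam)"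
    and "m \<ge> 1" and "m \<noteq> 1"
    and "f \<in> paley_wiener \<delta>"
    and "\<epsilon> > 0"
    and "\<And>l. ftilde l = f (of_int l / L) + e l"
    and "\<And>l. norm (e l) \<le> \<epsilon>"
    and "\<beta> = pi * real m * (1 + lam - 2 * \<tau>) / (1 + lam)"
  shows "C0_norm (\<lambda>t. shannon_sinh L m \<beta> ftilde t - shannon_sinh L m \<beta> (\<lambda>l. f (of_int l / L)) t)
     \<le> ennreal (\<epsilon> * (2 + sqrt ((2 + 2 * lam) / (1 + lam - 2 * \<tau>))
                        * (1 / (1 - exp (- 2 * \<beta>))) * sqrt (real m)))"
proof -
  have pos: "1 + lam - 2 * \<tau> > 0" "1 + lam > 0" "L > 0" "m > 0"
    using assms by (auto intro!: mult_pos_pos)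
  then have "\<beta> > 0"
    using assms(13) by auto
  have "2 * pi / \<beta> = (2 + 2 * lam) / (1 + lam - 2 * \<tau>) / real m"
  proof -
    have "2 * pi / (pi * real m * c / d) = 2 * d / c / real m" if "c > 0" "d > 0" for c d :: real
      using that pos by (simp add: field_simps)
    from this[OF pos(1,2)] show ?thesis
      by (simp add: assms(13) distrib_left)
  qed
  then have "real m * sqrt (2 * pi / \<beta>)
      = sqrt ((2 + 2 * lam) / (1 + lam - 2 * \<tau>)) * (real m / sqrt (real m))"
    by (simp add: real_sqrt_divide real_sqrt_mult)
  also have "real m / sqrt (real m) = sqrt (real m)"
    by (simp add: real_div_sqrt)
  finally have const: "real m * sqrt (2 * pi / \<beta>)
      = sqrt ((2 + 2 * lam) / (1 + lam - 2 * \<tau>)) * sqrt (real m)" .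
  have "norm (ftilde l - f (of_int l / L)) \<le> \<epsilon>" for l
    using assms(11,12) by simp
  from norm_shannon_sinh_diff_le[OF \<open>\<beta> > 0\<close> \<open>L > 0\<close> \<open>m > 0\<close> this, unfolded const]
  show ?thesis
    unfolding C0_norm_def by (intro SUP_least ennreal_leI) (simp add: mult_ac)
qed

end
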